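(* Let $ABCD$ be a square of side length $d$, let $E$ be a point on the line $DA$, and let $n$ be the parameter of the figure $\mathcal{H}=\mathcal{H}(n)$ made by the generalized Haga's fold with $E$ (as defined in the context). Then the value of $n$ satisfies: (h1) if $D$ lies between $E$ and $A$ and $|DE|>d$, then $-2<n<-1/2$; (h2) if $D$ is the midpoint of $EA$, then $n=-2$; (h3) if $D$ lies between $E$ and $A$ and $|DE|<d$, then $n<-2$; (h4) if $E=D$, then $n=\overline{0}$; (h5) if $E$ lies between $D$ and $A$, then $n>0$; (h6) if $E=A$, then $n=0$; (h7) if $A$ lies between $D$ and $E$, then $-1/2<n<0$. Within each of the cases (h1), (h3), (h5), (h7), $n$ is a monotonically decreasing function of $E$ as $E$ moves along the line $DA$ in the direction of $\overrightarrow{DA}$. Moreover, let $m$ be the perpendicular bisector of $CE$ (the crease line) and let $\rho=(1+\sqrt2)^2$. Then $m$ passes through the inside of $ABCD$ in the cases (h3), (h4), (h5), (h6); it does not pass through the inside of $ABCD$ in the cases (h1), (h2); and in the case (h7) it passes through the inside of $ABCD$ if and only if $-\rho^{-1}<n<0$.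
   Context: The figure made by the generalized Haga's fold: for a square $ABCD$ and a point $E$ on the line $DA$, let $m$ be the perpendicular bisector of the segment $CE$, let $G$ be the reflection of $B$ in $m$, and let $F$ be the point of intersection of the lines $AB$ and $EG$ if they meet (with $F=B$ if $E=A$). The figure consisting of $ABCD$ and the points $E$, $F$ (if it exists) and $G$ is denoted $\mathcal{H}$. Definition of the parameter $n$. Let $d=|AB|$ and let $\delta$ be the circle with center $C$ and radius $d$ (it touches the line $DA$ at $D$). Suppose $E\ne D$. Let $T$ be the point of contact of $\delta$ with the tangent of $\delta$ from $E$ other than the line $DA$, and let $\gamma$ be the circle that touches the line $DA$ and touches $\delta$ externally at $T$. Let $r$ be the radius of $\gamma$ and $K$ its point of contact with the line $DA$. Put $$\nu=\frac{\tau|AK|}{2r}+\frac12,$$ where $\tau=1$ if $\delta$ and $K$ lie on the same side of the line $AB$, and $\tau=-1$ otherwise. Then set $n=\nu$ if $T$ lies inside $ABCD$, $n=-\nu$ if $T$ lies outside $ABCD$, and $n=0$ if $T=B$. The figure $\mathcal{H}$ is then denoted $\mathcal{H}(n)$. If $E=D$, the figure is denoted $\mathcal{H}(\overline{0})$, i.e. $n$ is the symbol $\overline{0}$ (a label distinct from the parameter $0$). *)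

theory Defs
  imports "HOL-Analysis.Analysis"
begin

type_synonym point = "real ^ 2"

abbreviation line_through :: "point \<Rightarrow> point \<Rightarrow> point set" where
  "line_through P Q \<equiv> affine hull {P, Q}"

definition is_line :: "point set \<Rightarrow> bool" where
  "is_line L \<longleftrightarrow> (\<exists>P Q. P \<noteq> Q \<and> L = line_through P Q)"

definition is_square :: "point \<Rightarrow> point \<Rightarrow> point \<Rightarrow> point \<Rightarrow> bool" where
  "is_square A B C D \<longleftrightarrow>
     A \<noteq> B \<and>
     dist A B = dist B C \<and> dist B C = dist C D \<and> dist C D = dist D A \<and>
     (D - A) \<bullet> (B - A) = 0 \<and> (A - B) \<bullet> (C - B) = 0 \<and>
     (B - C) \<bullet> (D - C) = 0 \<and> (C - D) \<bullet> (A - D) = 0"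

abbreviation square_region :: "point \<Rightarrow> point \<Rightarrow> point \<Rightarrow> point \<Rightarrow> point set" where
  "square_region A B C D \<equiv> convex hull {A, B, C, D}"

definition perp_bisector :: "point \<Rightarrow> point \<Rightarrow> point set" where
  "perp_bisector P Q = {X. (X - midpoint P Q) \<bullet> (Q - P) = 0}"

text \<open>For a line \<open>L\<close>, \<^const>\<open>closest_point\<close> gives the foot of the perpendicular.\<close>

definition reflect_in :: "point set \<Rightarrow> point \<Rightarrow> point" where
  "reflect_in L P = 2 *\<^sub>R closest_point L P - P"

text \<open>The line \<open>L\<close>, resp. the circle with centre \<open>Q'\<close> and radius \<open>r'\<close>, is tangent to the circle
  with centre \<open>Q\<close> and radius \<open>r\<close>, the point of contact being \<open>T\<close>.\<close>

definition line_touches :: "point set \<Rightarrow> point \<Rightarrow> real \<Rightarrow> point \<Rightarrow> bool" where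
  "line_touches L Q r T \<longleftrightarrow> is_line L \<and> L \<inter> sphere Q r = {T}"

definition circles_touch_externally ::
    "point \<Rightarrow> real \<Rightarrow> point \<Rightarrow> real \<Rightarrow> point \<Rightarrow> bool" where
  "circles_touch_externally Q r Q' r' T \<longleftrightarrow>
     sphere Q r \<inter> sphere Q' r' = {T} \<and> ball Q r \<inter> ball Q' r' = {}"

text \<open>The set \<open>S\<close> may have points on \<open>L\<close> (below, a circle touching \<open>L\<close>); these are disregarded.\<close>

definition same_side :: "point set \<Rightarrow> point set \<Rightarrow> point \<Rightarrow> bool" where
  "same_side L S P \<longleftrightarrow> (\<forall>X \<in> S - L. closed_segment X P \<inter> L = {})"

record haga_figure =
  pt_A :: point
  pt_B :: point
  pt_C :: point
  pt_D :: point
  pt_E :: point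
  pt_F :: "point option"
  pt_G :: point

definition generalized_haga_fold ::
    "point \<Rightarrow> point \<Rightarrow> point \<Rightarrow> point \<Rightarrow> point \<Rightarrow> haga_figure" where
  "generalized_haga_fold A B C D E =
    (let m = perp_bisector C E;
         G = reflect_in m B;
         F = (if E = A then Some B
              else if line_through A B \<inter> line_through E G = {} then None
              else Some (THE F. F \<in> line_through A B \<inter> line_through E G))
     in \<lparr>pt_A = A, pt_B = B, pt_C = C, pt_D = D, pt_E = E, pt_F = F, pt_G = G\<rparr>)"

definition crease :: "haga_figure \<Rightarrow> point set" where
  "crease H = perp_bisector (pt_C H) (pt_E H)"

datatype haga_param = Num real | Zero_bar

definition haga_T :: "haga_figure \<Rightarrow> point" where
  "haga_T H =
    (let d = dist (pt_A H) (pt_B H); DA = line_through (pt_D H) (pt_A H)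
     in THE T. \<exists>L. L \<noteq> DA \<and> pt_E H \<in> L \<and> line_touches L (pt_C H) d T)"

text \<open>Centre \<open>Q\<close> and radius \<open>r\<close> of the circle \<open>\<gamma>\<close>, and its point of contact \<open>K\<close> with the
  line \<open>DA\<close>.\<close>

definition haga_gamma :: "haga_figure \<Rightarrow> point \<times> real \<times> point" where
  "haga_gamma H =
    (let d = dist (pt_A H) (pt_B H); DA = line_through (pt_D H) (pt_A H)
     in THE (Q, r, K). 0 < r \<and> line_touches DA Q r K \<and>
          circles_touch_externally (pt_C H) d Q r (haga_T H))"

definition haga_nu :: "haga_figure \<Rightarrow> real" where
  "haga_nu H =
    (let A = pt_A H; B = pt_B H;
         \<delta> = sphere (pt_C H) (dist A B);
         (Q, r, K) = haga_gamma H;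
         \<tau> = (if same_side (line_through A B) \<delta> K then 1 else -1)
     in \<tau> * dist A K / (2 * r) + 1 / 2)"

text \<open>The only point other than \<open>D\<close> in which the circle \<open>\<delta>\<close> meets the boundary of the square is
  \<open>B\<close>, so the final \<open>undefined\<close> is never reached.\<close>

definition haga_parameter :: "haga_figure \<Rightarrow> haga_param" where
  "haga_parameter H =
    (let S = square_region (pt_A H) (pt_B H) (pt_C H) (pt_D H); T = haga_T H
     in if pt_E H = pt_D H then Zero_bar
        else if T \<in> interior S then Num (haga_nu H)
        else if T \<notin> S then Num (- haga_nu H)
        else if T = pt_B H then Num 0
        else undefined)"

end

theory Submission
  imports Defs
begin

text \<open>In the coordinates with origin \<open>D\<close> and axes \<open>DA\<close> and \<open>DC\<close>, measured in units of the side,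
  everything is a rational function of the coordinate \<open>s\<close> of \<open>E = (s, 0)\<close>. The point \<open>T\<close> is the
  reflection \<open>(2s, 2s\<^sup>2) / (1 + s\<^sup>2)\<close> of \<open>D\<close> in \<open>CE\<close>. The tangent segments \<open>ED\<close>, \<open>ET\<close> and \<open>EK\<close> are equally
  long, so \<open>K = (2s, 0)\<close>; and \<open>\<gamma>\<close> has radius \<open>s\<^sup>2\<close>. Therefore
  \<open>\<nu> = (1 - 2s) / (2s\<^sup>2) + 1/2 = (1 - 1/s)\<^sup>2 / 2\<close>, which is \<open>n\<close> for \<open>0 < s \<le> 1\<close> and \<open>- n\<close> for other
  \<open>s \<noteq> 0\<close> (\<open>haga_T_fig\<close>, \<open>haga_gamma_fig\<close>, \<open>haga_nu_fig\<close>, \<open>haga_parameter_fig\<close>). The cases of the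
  theorem are \<open>s < -1\<close>, \<open>s = -1\<close>, \<open>-1 < s < 0\<close>, \<open>s = 0\<close>, \<open>0 < s < 1\<close>, \<open>s = 1\<close> and \<open>s > 1\<close>, so that the
  bounds and the monotonicity of \<open>n\<close> become those of an explicit function of \<open>1/s\<close>.

  The crease has the equation \<open>y = s x + (1 - s\<^sup>2) / 2\<close>. It meets the open unit square iff
  \<open>-1 < s < 1 + sqrt 2\<close> (\<open>crease_meets_interior_iff\<close>), and \<open>n = - 1/\<rho>\<close> at \<open>s = 1 + sqrt 2\<close>.

  The work lies in showing that the tangency conditions which define \<open>T\<close> and \<open>\<gamma>\<close> determine them
  uniquely. To this end, tangency is first rewritten as an equation between vectors
  (\<open>line_touches_iff\<close>, \<open>circles_touch_externally_iff\<close>).\<close>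

section \<open>Tangency\<close>

text \<open>If a line through the point \<open>T\<close> of a circle is not perpendicular to the radius at \<open>T\<close>,
  reflecting \<open>T\<close> in the foot of the perpendicular from the centre gives a second common point.\<close>

lemma line_touches_iff:
  "line_touches L Q r T \<longleftrightarrow>
     is_line L \<and> T \<in> L \<and> dist Q T = r \<and> (\<forall>X \<in> L. (X - T) \<bullet> (T - Q) = 0)"
proof
  assume touch: "line_touches L Q r T"
  then obtain P P' where L: "L = range (\<lambda>c. P + c *\<^sub>R (P' - P))" and line: "is_line L"
    by (auto simp: line_touches_def is_line_def affine_hull_2_alt)
  from touch have only: "L \<inter> sphere Q r = {T}"
    by (simp add: line_touches_def)
  then have T: "T \<in> L" and r: "dist Q T = r"
    by auto
  have "(X - T) \<bullet> (T - Q) = 0" if X: "X \<in> L" for X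
  proof (cases "X = T")
    case False
    define w where "w = X - T"
    define c where "c = - 2 * (w \<bullet> (T - Q)) / (w \<bullet> w)"
    have w: "w \<bullet> w \<noteq> 0"
      using False by (simp add: w_def)
    obtain a b where ab: "X = P + a *\<^sub>R (P' - P)" "T = P + b *\<^sub>R (P' - P)"
      using X T L by blast
    have "T + c *\<^sub>R w = P + (b + c * (a - b)) *\<^sub>R (P' - P)"
      by (simp add: w_def ab algebra_simps)
    then have "T + c *\<^sub>R w \<in> L"
      using L by blast
    moreover have "(T + c *\<^sub>R w - Q) \<bullet> (T + c *\<^sub>R w - Q) = (T - Q) \<bullet> (T - Q)"
    proof -
      have "(T + c *\<^sub>R w - Q) \<bullet> (T + c *\<^sub>R w - Q) =
          (T - Q) \<bullet> (T - Q) + c * (2 * (w \<bullet> (T - Q)) + c * (w \<bullet> w))"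
        by (simp add: inner_diff_left inner_diff_right inner_add_left inner_add_right
            inner_commute algebra_simps)
      also have "2 * (w \<bullet> (T - Q)) + c * (w \<bullet> w) = 0"
        using w by (simp add: c_def)
      finally show ?thesis
        by simp
    qed
    then have "dist (T + c *\<^sub>R w) Q = dist T Q"
      by (simp only: dist_norm norm_eq_sqrt_inner)
    then have "dist Q (T + c *\<^sub>R w) = r"
      using r by (simp only: dist_commute[of _ Q])
    ultimately have "T + c *\<^sub>R w = T"
      using only by (metis IntI mem_sphere singletonD)
    then show ?thesis
      using w by (auto simp: c_def w_def)
  qed simp
  with line T r show "is_line L \<and> T \<in> L \<and> dist Q T = r \<and> (\<forall>X \<in> L. (X - T) \<bullet> (T - Q) = 0)"
    by blast
next
  assume rhs: "is_line L \<and> T \<in> L \<and> dist Q T = r \<and> (\<forall>X \<in> L. (X - T) \<bullet> (T - Q) = 0)"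
  have "X = T" if "X \<in> L" "dist Q X = r" for X
  proof -
    have "norm (X - Q) = norm (T - Q)"
      using that(2) rhs by (simp add: dist_norm norm_minus_commute)
    then have "(X - Q) \<bullet> (X - Q) = (T - Q) \<bullet> (T - Q)"
      by (simp add: dot_square_norm)
    also have "(X - Q) \<bullet> (X - Q) =
        (X - T) \<bullet> (X - T) + 2 * ((X - T) \<bullet> (T - Q)) + (T - Q) \<bullet> (T - Q)"
      by (simp add: inner_diff_left inner_diff_right inner_commute)
    finally show ?thesis
      using rhs that(1) by simp
  qed
  with rhs show "line_touches L Q r T"
    by (auto simp: line_touches_def)
qed

text \<open>Disjointness of the discs forces the centres to be at distance at least \<open>r + r'\<close>, and a
  common point of the circles makes this distance at most \<open>r + r'\<close>. Equality in the triangle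
  inequality then puts the common point between the centres.\<close>

lemma circles_touch_externally_iff:
  assumes "0 < r" "0 < r'"
  shows "circles_touch_externally Q r Q' r' T \<longleftrightarrow>
     dist Q T = r \<and> r *\<^sub>R (Q' - T) = r' *\<^sub>R (T - Q)"
proof
  assume touch: "circles_touch_externally Q r Q' r' T"
  then have T: "dist Q T = r" "dist Q' T = r'"
    by (auto simp: circles_touch_externally_def)
  have "r + r' \<le> dist Q Q'"
  proof (rule ccontr)
    assume *: "\<not> r + r' \<le> dist Q Q'"
    define X where "X = Q + (r / (r + r')) *\<^sub>R (Q' - Q)"
    have "Q - X = (r / (r + r')) *\<^sub>R (Q - Q')"
      by (simp add: X_def algebra_simps)
    moreover have "Q' - X = (1 - r / (r + r')) *\<^sub>R (Q' - Q)"
      by (simp add: X_def algebra_simps)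
    moreover have "1 - r / (r + r') = r' / (r + r')"
      using assms by (simp add: field_simps)
    ultimately have "dist Q X = r / (r + r') * dist Q Q'" "dist Q' X = r' / (r + r') * dist Q Q'"
      using assms by (simp_all add: dist_norm norm_minus_commute)
    then have "dist Q X < r" "dist Q' X < r'"
      using * assms by (simp_all add: pos_divide_less_eq)
    then show False
      using touch by (auto simp: circles_touch_externally_def)
  qed
  moreover have "dist Q Q' \<le> r + r'"
    using T dist_triangle[of Q Q' T] by (simp add: dist_commute)
  ultimately have "norm ((T - Q) + (Q' - T)) = norm (T - Q) + norm (Q' - T)"
    using T by (simp add: dist_norm norm_minus_commute)
  then have "norm (T - Q) *\<^sub>R (Q' - T) = norm (Q' - T) *\<^sub>R (T - Q)"
    by (simp only: norm_triangle_eq)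
  then show "dist Q T = r \<and> r *\<^sub>R (Q' - T) = r' *\<^sub>R (T - Q)"
    using T by (simp add: dist_norm norm_minus_commute)
next
  assume rhs: "dist Q T = r \<and> r *\<^sub>R (Q' - T) = r' *\<^sub>R (T - Q)"
  have "r * norm (Q' - T) = r' * r"
    using arg_cong[where f = norm, OF conjunct2[OF rhs]] conjunct1[OF rhs] assms
    by (simp add: dist_norm norm_minus_commute)
  then have T': "dist Q' T = r'"
    using assms by (simp add: dist_norm)
  have QQ': "r *\<^sub>R (Q' - Q) = (r + r') *\<^sub>R (T - Q)"
    using rhs by (simp add: algebra_simps)
  have "r * norm (Q' - Q) = (r + r') * r"
    using arg_cong[where f = norm, OF QQ'] conjunct1[OF rhs] assms
    by (simp add: dist_norm norm_minus_commute)
  then have dist: "dist Q Q' = r + r'"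
    using assms by (simp add: dist_norm norm_minus_commute)
  have "X = T" if X: "dist Q X = r" "dist Q' X = r'" for X
  proof -
    have "norm ((X - Q) + (Q' - X)) = norm (X - Q) + norm (Q' - X)"
      using X dist by (simp add: dist_norm norm_minus_commute)
    then have "norm (X - Q) *\<^sub>R (Q' - X) = norm (Q' - X) *\<^sub>R (X - Q)"
      by (simp only: norm_triangle_eq)
    then have "r *\<^sub>R (Q' - X) = r' *\<^sub>R (X - Q)"
      using X by (simp add: dist_norm norm_minus_commute)
    then have "(r + r') *\<^sub>R X = (r + r') *\<^sub>R T"
      using QQ' by (simp add: algebra_simps)
    then show ?thesis
      using assms by simp
  qed
  moreover have "ball Q r \<inter> ball Q' r' = {}"
    using dist by (intro disjoint_ballI) simp
  ultimately show "circles_touch_externally Q r Q' r' T"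
    using rhs T' by (auto simp: circles_touch_externally_def)
qed

lemma is_line_eq:
  assumes "is_line L" "X \<in> L" "Y \<in> L" "X \<noteq> Y"
  shows "L = line_through X Y"
proof -
  obtain P P' where L: "L = range (\<lambda>c. P + c *\<^sub>R (P' - P))"
    using assms(1) by (auto simp: is_line_def affine_hull_2_alt)
  then obtain a b where ab: "X = P + a *\<^sub>R (P' - P)" "Y = P + b *\<^sub>R (P' - P)"
    using assms(2,3) by blast
  then have "a \<noteq> b"
    using assms(4) by auto
  have "P + c *\<^sub>R (P' - P) = X + ((c - a) / (b - a)) *\<^sub>R (Y - X)" for c
  proof -
    have "Y - X = (b - a) *\<^sub>R (P' - P)"
      by (simp add: ab algebra_simps)
    then have "X + ((c - a) / (b - a)) *\<^sub>R (Y - X) = X + (c - a) *\<^sub>R (P' - P)"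
      using \<open>a \<noteq> b\<close> by simp
    also have "\<dots> = P + c *\<^sub>R (P' - P)"
      by (simp add: ab algebra_simps)
    finally show ?thesis ..
  qed
  moreover have "X + c *\<^sub>R (Y - X) = P + (a + c * (b - a)) *\<^sub>R (P' - P)" for c
    by (simp add: ab algebra_simps)
  ultimately have "range (\<lambda>c. P + c *\<^sub>R (P' - P)) = range (\<lambda>c. X + c *\<^sub>R (Y - X))"
    by (intro subset_antisym image_subsetI) (metis rangeI)+
  then show ?thesis
    by (simp add: L affine_hull_2_alt)
qed

section \<open>Coordinates adapted to the square\<close>

locale square =
  fixes A B C D :: point
  assumes is_square: "is_square A B C D"
begin

definition side :: real where
  "side = dist A B"

definition pt :: "real \<Rightarrow> real \<Rightarrow> point" where
  "pt x y = D + x *\<^sub>R (A - D) + y *\<^sub>R (C - D)"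

lemma side_pos: "0 < side"
  using is_square by (auto simp: is_square_def side_def)

text \<open>Write \<open>a\<close>, \<open>b\<close>, \<open>c\<close>, \<open>e\<close> for the sides as vectors, so that their sum is \<open>0\<close>. Taking the inner
  product of the sum with \<open>a\<close> gives \<open>a \<bullet> c = - (a \<bullet> a)\<close>; as \<open>a\<close> and \<open>c\<close> have the same length,
  \<open>c = - a\<close>.\<close>

lemma parallelogram: "B - A = C - D"
proof -
  have 1: "(B - A) \<bullet> (B - A) = (D - C) \<bullet> (D - C)"
    using is_square by (simp add: is_square_def dot_square_norm dist_norm norm_minus_commute)
  have "(B - A) \<bullet> (C - B) = 0" "(B - A) \<bullet> (A - D) = 0"
    using is_square by (simp_all add: is_square_def inner_diff_left inner_diff_right inner_commute)
  then have "(B - A) \<bullet> (D - C) = - ((B - A) \<bullet> (B - A))"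
    by (simp add: inner_diff_left inner_diff_right inner_commute)
  then have "((B - A) + (D - C)) \<bullet> ((B - A) + (D - C)) = 0"
    using 1 by (simp only: inner_add_left inner_add_right inner_commute[of "D - C" "B - A"])
  then have "(B - A) + (D - C) = 0"
    by (simp only: inner_eq_zero_iff)
  then show ?thesis
    by (simp add: algebra_simps)
qed

text \<open>Since \<open>pt\<close> itself involves \<open>A\<close>, \<open>C\<close> and \<open>D\<close>, rewriting with these equations terminates only from
  right to left.\<close>

lemma vertices: "A = pt 1 0" "B = pt 1 1" "C = pt 0 1" "D = pt 0 0"
proof -
  show "B = pt 1 1"
    using parallelogram by (simp add: pt_def algebra_simps)
qed (simp_all add: pt_def)

lemma inner_axes:
  "(A - D) \<bullet> (A - D) = side\<^sup>2" "(C - D) \<bullet> (C - D) = side\<^sup>2" "(A - D) \<bullet> (C - D) = 0"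
  using is_square
  by (auto simp: is_square_def side_def dot_square_norm dist_norm norm_minus_commute inner_commute)

lemma inner_pt:
  "(pt x y - pt x' y') \<bullet> (pt a b - pt a' b') = side\<^sup>2 * ((x - x') * (a - a') + (y - y') * (b - b'))"
proof -
  have diff: "pt x y - pt x' y' = (x - x') *\<^sub>R (A - D) + (y - y') *\<^sub>R (C - D)" for x y x' y'
    by (simp add: pt_def algebra_simps)
  show ?thesis
    unfolding diff inner_add_left inner_add_right inner_scaleR_left inner_scaleR_right inner_axes
      inner_commute[of "C - D" "A - D"]
    by (simp add: algebra_simps)
qed

lemma dist_pt: "dist (pt x y) (pt x' y') = side * sqrt ((x - x')\<^sup>2 + (y - y')\<^sup>2)"
  using side_pos
  by (simp add: dist_norm norm_eq_sqrt_inner inner_pt real_sqrt_mult power2_eq_square)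

lemma pt_eq_iff [simp]: "pt x y = pt x' y' \<longleftrightarrow> x = x' \<and> y = y'"
proof -
  have "pt x y = pt x' y' \<longleftrightarrow> dist (pt x y) (pt x' y') = 0"
    by simp
  also have "\<dots> \<longleftrightarrow> x = x' \<and> y = y'"
    using side_pos by (simp add: dist_pt sum_power2_eq_zero_iff del: dist_eq_0_iff)
  finally show ?thesis .
qed

text \<open>Two nonzero orthogonal vectors span the plane.\<close>

lemma pt_cases: obtains x y where "P = pt x y"
proof -
  define a where "a = A - D"
  define c where "c = C - D"
  have orth: "a \<bullet> c = 0" "a \<noteq> 0" "c \<noteq> 0"
    using inner_axes side_pos by (auto simp: a_def c_def)
  have "a \<noteq> c"
    using orth by auto
  moreover have "independent {a, c}"
    using orth by (intro pairwise_orthogonal_independent)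
      (auto simp: pairwise_def orthogonal_def inner_commute)
  ultimately have "span {a, c} = UNIV"
    using independent_card_le dim_eq_full[of "{a, c}"] by (simp add: dim_eq_card_independent)
  then have "P - D \<in> span {a, c}"
    by simp
  then obtain x y where "P - D = x *\<^sub>R a + y *\<^sub>R c"
    by (auto simp: span_insert span_singleton algebra_simps)
  then have "P = pt x y"
    by (simp add: pt_def a_def c_def algebra_simps)
  then show thesis
    by (rule that)
qed

lemma segment_pt:
  "X \<in> closed_segment (pt x y) (pt x' y') \<longleftrightarrow>
     (\<exists>t. 0 \<le> t \<and> t \<le> 1 \<and> X = pt ((1 - t) * x + t * x') ((1 - t) * y + t * y'))"
proof -
  have "(1 - t) *\<^sub>R pt x y + t *\<^sub>R pt x' y' = pt ((1 - t) * x + t * x') ((1 - t) * y + t * y')" for t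
    by (simp add: pt_def algebra_simps)
  then show ?thesis
    by (simp add: in_segment conj_ac)
qed

lemma line_pt:
  "line_through (pt x y) (pt x' y') = range (\<lambda>t. pt (x + t * (x' - x)) (y + t * (y' - y)))"
proof -
  have "pt x y + t *\<^sub>R (pt x' y' - pt x y) = pt (x + t * (x' - x)) (y + t * (y' - y))" for t
    by (simp add: pt_def algebra_simps)
  then show ?thesis
    by (simp add: affine_hull_2_alt)
qed

lemma line_DA: "line_through D A = range (\<lambda>s. pt s 0)"
  using line_pt[of 0 0 1 0] by (simp flip: vertices)

lemma line_AB: "line_through A B = range (\<lambda>y. pt 1 y)"
  using line_pt[of 1 0 1 1] by (simp flip: vertices)

lemma is_line_DA: "is_line (line_through D A)"
proof -
  have "D \<noteq> A"
    using vertices(1,4) pt_eq_iff[of 0 0 1 0] by auto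
  then show ?thesis
    by (auto simp: is_line_def)
qed

text \<open>The square is an intersection of four half-planes, and taking the interior commutes with finite
  intersections.\<close>

lemma mem_square_region:
  "pt x y \<in> square_region A B C D \<longleftrightarrow> 0 \<le> x \<and> x \<le> 1 \<and> 0 \<le> y \<and> y \<le> 1" (is ?mem)
  and mem_interior_square_region:
  "pt x y \<in> interior (square_region A B C D) \<longleftrightarrow> 0 < x \<and> x < 1 \<and> 0 < y \<and> y < 1" (is ?interior)
proof -
  define a where "a = A - D"
  define c where "c = C - D"
  have a0: "a \<noteq> 0"
    using inner_axes(1) side_pos by (auto simp: a_def)
  have c0: "c \<noteq> 0"
    using inner_axes(2) side_pos by (auto simp: c_def)
  define R where "R = {X. a \<bullet> X \<ge> a \<bullet> D} \<inter> {X. a \<bullet> X \<le> a \<bullet> D + side\<^sup>2} \<inter>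
    ({X. c \<bullet> X \<ge> c \<bullet> D} \<inter> {X. c \<bullet> X \<le> c \<bullet> D + side\<^sup>2})"
  have inner: "a \<bullet> pt x y = a \<bullet> D + side\<^sup>2 * x" "c \<bullet> pt x y = c \<bullet> D + side\<^sup>2 * y" for x y
    using inner_axes
    by (simp_all add: pt_def inner_add_right a_def c_def inner_commute[of "C - D" "A - D"])
  have R: "pt x y \<in> R \<longleftrightarrow> 0 \<le> x \<and> x \<le> 1 \<and> 0 \<le> y \<and> y \<le> 1" for x y
    using side_pos by (auto simp: R_def inner zero_le_mult_iff mult_le_cancel_left1)
  have "convex R"
    unfolding R_def
    by (intro convex_Int convex_halfspace_le convex_halfspace_ge)
  moreover have "{A, B, C, D} \<subseteq> R"
    using R[of 1 0] R[of 1 1] R[of 0 1] R[of 0 0] by (simp flip: vertices)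
  ultimately have "square_region A B C D \<subseteq> R"
    by (rule hull_minimal[rotated])
  moreover have "pt x y \<in> square_region A B C D" if "0 \<le> x" "x \<le> 1" "0 \<le> y" "y \<le> 1" for x y
  proof -
    let ?S = "square_region A B C D"
    have S: "convex ?S" "A \<in> ?S" "B \<in> ?S" "C \<in> ?S" "D \<in> ?S"
      by (auto simp: convex_convex_hull intro: hull_inc)
    have "pt x 0 \<in> closed_segment D A" "pt x 1 \<in> closed_segment C B"
      using that segment_pt[of "pt x 0" 0 0 1 0] segment_pt[of "pt x 1" 0 1 1 1]
      by (auto simp flip: vertices)
    then have "pt x 0 \<in> ?S" "pt x 1 \<in> ?S"
      using closed_segment_subset[of D ?S A] closed_segment_subset[of C ?S B] S by auto
    moreover have "pt x y \<in> closed_segment (pt x 0) (pt x 1)"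
      using that by (auto simp: segment_pt algebra_simps)
    ultimately show ?thesis
      using closed_segment_subset[of "pt x 0" ?S "pt x 1"] S by auto
  qed
  then have "R \<subseteq> square_region A B C D"
    using R by (metis pt_cases subsetI)
  ultimately have eq: "square_region A B C D = R"
    by simp
  show ?mem
    by (simp add: eq R)
  have "interior R = {X. a \<bullet> X > a \<bullet> D} \<inter> {X. a \<bullet> X < a \<bullet> D + side\<^sup>2} \<inter>
    ({X. c \<bullet> X > c \<bullet> D} \<inter> {X. c \<bullet> X < c \<bullet> D + side\<^sup>2})"
    unfolding R_def interior_Int
    by (simp add: interior_halfspace_le interior_halfspace_ge a0 c0)
  then show ?interior
    using side_pos by (auto simp: eq inner zero_less_mult_iff mult_less_cancel_left1)
qed

lemma scaleR_pt_diff: "c *\<^sub>R (pt x y - pt x' y') = pt (c * (x - x')) (c * (y - y')) - pt 0 0"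
  by (simp add: pt_def algebra_simps)

lemma midpoint_pt: "midpoint (pt x y) (pt x' y') = pt ((x + x') / 2) ((y + y') / 2)"
proof -
  have sum: "pt x y + pt x' y' = D + pt (x + x') (y + y')" for x y x' y'
    by (simp add: pt_def algebra_simps)
  show ?thesis
    unfolding midpoint_eq_iff sum by (simp add: field_sum_of_halves)
qed

lemma open_segment_DA:
  "pt c 0 \<in> open_segment (pt a 0) (pt b 0) \<longleftrightarrow> (a < c \<and> c < b) \<or> (b < c \<and> c < a)"
proof -
  have "pt c 0 \<in> closed_segment (pt a 0) (pt b 0) \<longleftrightarrow> c \<in> closed_segment a b"
    unfolding segment_pt by (auto simp: in_segment)
  then show ?thesis
    by (auto simp: open_segment_def closed_segment_eq_real_ivl split: if_splits)
qed

section \<open>The parameter in coordinates\<close>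

abbreviation fig :: "real \<Rightarrow> haga_figure" where
  "fig s \<equiv> generalized_haga_fold A B C D (pt s 0)"

lemma fig_sel [simp]:
  "pt_A (fig s) = A" "pt_B (fig s) = B" "pt_C (fig s) = C" "pt_D (fig s) = D"
  "pt_E (fig s) = pt s 0"
  by (simp_all add: generalized_haga_fold_def Let_def)

text \<open>The point \<open>T\<close> is the reflection of \<open>D\<close> in the line \<open>CE\<close>. Perpendicularity of \<open>ET\<close> and \<open>CT\<close>
  together with the equation of \<open>\<delta>\<close> leaves only this point and \<open>D\<close>, and a tangent at \<open>D\<close> is the line
  \<open>DA\<close>.\<close>

lemma haga_T_fig:
  assumes "s \<noteq> 0"
  shows "haga_T (fig s) = pt (2 * s / (1 + s\<^sup>2)) (2 * s\<^sup>2 / (1 + s\<^sup>2))" (is "_ = ?T")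
proof -
  have s2: "1 + s\<^sup>2 \<noteq> 0" "0 < 1 + s\<^sup>2"
    by (auto simp: add_nonneg_eq_0_iff add_pos_nonneg)
  define x0 y0 where "x0 = 2 * s / (1 + s\<^sup>2)" and "y0 = 2 * s\<^sup>2 / (1 + s\<^sup>2)"
  have y0: "y0 = s * x0" "y0 \<noteq> 0"
    using assms s2 by (auto simp: x0_def y0_def power2_eq_square)
  have x0: "(1 + s\<^sup>2) * x0 = 2 * s"
    using s2 by (simp add: x0_def)
  have circle: "x0 * x0 + y0 * y0 = 2 * y0"
    using x0 unfolding y0 by algebra
  have E: "pt s 0 \<noteq> D"
    using assms pt_eq_iff[of s 0 0 0] by (simp flip: vertices)
  have "(\<exists>L. L \<noteq> line_through D A \<and> pt s 0 \<in> L \<and> line_touches L C side T) \<longleftrightarrow> T = pt x0 y0" for T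
  proof
    assume "\<exists>L. L \<noteq> line_through D A \<and> pt s 0 \<in> L \<and> line_touches L C side T"
    then obtain L where L: "L \<noteq> line_through D A" "pt s 0 \<in> L" "is_line L" "T \<in> L"
        "dist C T = side" "(pt s 0 - T) \<bullet> (T - C) = 0"
      by (auto simp: line_touches_iff)
    obtain x y where T: "T = pt x y"
      by (rule pt_cases)
    have "dist (pt 0 1) (pt x y) = side"
      using L T by (simp flip: vertices)
    then have 1: "x * x + y * y = 2 * y"
      using side_pos by (simp add: dist_pt power2_eq_square algebra_simps)
    have "(pt s 0 - pt x y) \<bullet> (pt x y - pt 0 1) = 0"
      using L T by (simp flip: vertices)
    then have "(s - x) * x + (0 - y) * (y - 1) = 0"
      using side_pos unfolding inner_pt by simp
    then have 2: "y = s * x"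
      using 1 by (simp add: algebra_simps)
    have "x \<noteq> 0"
    proof
      assume "x = 0"
      then have "T = D"
        using 2 T by (simp flip: vertices)
      then have "L = line_through D (pt s 0)"
        using L E by (intro is_line_eq) auto
      moreover have "line_through D A = line_through D (pt s 0)"
      proof (rule is_line_eq)
        show "pt s 0 \<in> line_through D A"
          by (simp add: line_DA)
      qed (use E is_line_DA in \<open>auto intro: hull_inc\<close>)
      ultimately show False
        using L by simp
    qed
    moreover have "x * ((1 + s\<^sup>2) * x - 2 * s) = 0"
      using 1 unfolding 2 by algebra
    ultimately have "(1 + s\<^sup>2) * x = 2 * s"
      by simp
    then have "x = x0"
      using s2(1) x0 by (metis mult_left_cancel)
    then show "T = pt x0 y0"
      using T y0 2 by simp
  next
    assume T: "T = pt x0 y0"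
    let ?L = "line_through (pt s 0) T"
    have "T \<in> ?L" "pt s 0 \<in> ?L"
      by (auto intro: hull_inc)
    moreover have "is_line ?L"
      unfolding is_line_def using y0 T by (intro exI[of _ "pt s 0"] exI[of _ T]) auto
    moreover have "?L \<noteq> line_through D A"
      using \<open>T \<in> ?L\<close> T y0(2) line_DA by auto
    moreover have "dist (pt 0 1) (pt x0 y0) = side"
    proof -
      have "(0 - x0)\<^sup>2 + (1 - y0)\<^sup>2 = 1"
        using circle by (simp add: power2_eq_square algebra_simps)
      then show ?thesis
        by (simp add: dist_pt)
    qed
    then have "dist C T = side"
      by (simp add: T flip: vertices)
    moreover have "(X - T) \<bullet> (T - C) = 0" if X: "X \<in> ?L" for X
    proof -
      obtain t where t: "X = pt (s + t * (x0 - s)) (0 + t * (y0 - 0))"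
        using X unfolding T line_pt by blast
      have "(X - T) \<bullet> (T - pt 0 1) = side\<^sup>2 * ((1 - t) * (s * x0 + y0 - (x0 * x0 + y0 * y0)))"
        unfolding t T inner_pt by (simp add: algebra_simps)
      then show ?thesis
        using circle y0 by (simp flip: vertices)
    qed
    ultimately show "\<exists>L. L \<noteq> line_through D A \<and> pt s 0 \<in> L \<and> line_touches L C side T"
      unfolding line_touches_iff by blast
  qed
  then show ?thesis
    by (simp add: haga_T_def Let_def x0_def y0_def side_def[symmetric])
qed

text \<open>The tangents to \<open>\<gamma>\<close> from \<open>E\<close> touch it at \<open>K\<close> and \<open>T\<close>, so \<open>|EK| = |ET| = |ED|\<close> and \<open>K\<close> is the
  image of \<open>D\<close> under the point reflection in \<open>E\<close>. A circle \<open>\<gamma>\<close> on the other side of \<open>DA\<close> is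
  excluded because \<open>T\<close> has a positive second coordinate.\<close>

lemma haga_gamma_fig:
  assumes "s \<noteq> 0"
  shows "haga_gamma (fig s) = (pt (2 * s) (s\<^sup>2), side * s\<^sup>2, pt (2 * s) 0)"
proof -
  have s2: "1 + s\<^sup>2 \<noteq> 0" "0 < 1 + s\<^sup>2" "0 < s\<^sup>2"
    using assms by (auto simp: add_nonneg_eq_0_iff add_pos_nonneg)
  define x y where "x = 2 * s / (1 + s\<^sup>2)" and "y = 2 * s\<^sup>2 / (1 + s\<^sup>2)"
  have xy: "(1 + s\<^sup>2) * x = 2 * s" "(1 + s\<^sup>2) * y = 2 * s\<^sup>2"
    using s2(1) by (simp_all add: x_def y_def)
  have y: "0 < y"
    unfolding y_def by (intro divide_pos_pos mult_pos_pos s2) simp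
  let ?P = "\<lambda>Q r K. 0 < r \<and> line_touches (line_through D A) Q r K \<and>
    circles_touch_externally C side Q r (pt x y)"
  have T: "dist C (pt x y) = side"
  proof -
    have "x * x + y * y = 2 * y"
      using xy(1,2) s2 by algebra
    then have "(0 - x)\<^sup>2 + (1 - y)\<^sup>2 = 1"
      by (simp add: power2_eq_square algebra_simps)
    then have "dist (pt 0 1) (pt x y) = side"
      by (simp add: dist_pt)
    then show ?thesis
      by (simp flip: vertices)
  qed
  have line: "line_touches (line_through D A) (pt a b) r (pt k 0) \<longleftrightarrow> a = k \<and> r = side * \<bar>b\<bar>" for a b r k
  proof -
    have "(\<forall>X \<in> line_through D A. (X - pt k 0) \<bullet> (pt k 0 - pt a b) = 0) \<longleftrightarrow>
        (\<forall>t. (t - k) * (k - a) = 0)"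
      using side_pos by (simp add: line_DA inner_pt)
    also have "\<dots> \<longleftrightarrow> a = k"
      by (auto dest: spec[of _ "k + 1"])
    finally show ?thesis
      using is_line_DA by (auto simp: line_touches_iff line_DA dist_pt)
  qed
  have circ: "circles_touch_externally C side (pt k b) (side * \<bar>b\<bar>) (pt x y) \<longleftrightarrow>
      k - x = \<bar>b\<bar> * x \<and> b - y = \<bar>b\<bar> * (y - 1)" if "b \<noteq> 0" for k b
  proof -
    have "side *\<^sub>R (pt k b - pt x y) = (side * \<bar>b\<bar>) *\<^sub>R (pt x y - pt 0 1) \<longleftrightarrow>
        k - x = \<bar>b\<bar> * x \<and> b - y = \<bar>b\<bar> * (y - 1)"
      using side_pos unfolding scaleR_pt_diff by simp
    then show ?thesis
      using that side_pos T by (simp add: circles_touch_externally_iff flip: vertices)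
  qed
  have "?P Q r K \<longleftrightarrow> Q = pt (2 * s) (s\<^sup>2) \<and> r = side * s\<^sup>2 \<and> K = pt (2 * s) 0" for Q r K
  proof
    assume P: "?P Q r K"
    obtain a b where Q: "Q = pt a b"
      by (rule pt_cases)
    have "K \<in> line_through D A"
      using P by (simp add: line_touches_iff)
    then obtain k where K: "K = pt k 0"
      by (auto simp: line_DA)
    have r: "a = k" "r = side * \<bar>b\<bar>"
      using P by (simp_all add: Q K line)
    then have b: "b \<noteq> 0"
      using P by auto
    with P have eq: "k - x = \<bar>b\<bar> * x" "b - y = \<bar>b\<bar> * (y - 1)"
      by (simp_all add: Q r circ)
    have "0 < b"
    proof (rule ccontr)
      assume "\<not> 0 < b"
      then have "y = b * y" "b < 0"
        using eq(2) b by (simp_all add: algebra_simps)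
      then show False
        using y by simp
    qed
    then have "k = (1 + b) * x" "2 * b = (1 + b) * y"
      using eq by (simp_all add: algebra_simps)
    then have "2 * b * (1 + s\<^sup>2) = (1 + b) * (2 * s\<^sup>2)"
      using xy(2) by (simp add: ac_simps)
    then have "b = s\<^sup>2"
      by (simp add: algebra_simps)
    moreover have "k = 2 * s"
      using \<open>k = (1 + b) * x\<close> \<open>b = s\<^sup>2\<close> xy(1) by simp
    ultimately show "Q = pt (2 * s) (s\<^sup>2) \<and> r = side * s\<^sup>2 \<and> K = pt (2 * s) 0"
      by (simp add: Q K r)
  next
    assume "Q = pt (2 * s) (s\<^sup>2) \<and> r = side * s\<^sup>2 \<and> K = pt (2 * s) 0"
    moreover have "circles_touch_externally C side (pt (2 * s) (s\<^sup>2)) (side * s\<^sup>2) (pt x y)"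
      using circ[of "s\<^sup>2" "2 * s"] s2 xy by (simp add: algebra_simps)
    ultimately show "?P Q r K"
      using line side_pos s2 by auto
  qed
  then have "(\<lambda>(Q, r, K). ?P Q r K) = (\<lambda>p. p = (pt (2 * s) (s\<^sup>2), side * s\<^sup>2, pt (2 * s) 0))"
    by (auto simp: fun_eq_iff)
  then show ?thesis
    using assms by (simp add: haga_gamma_def Let_def haga_T_fig side_def x_def y_def)
qed

lemma same_side_AB: "same_side (line_through A B) (sphere C side) (pt k 0) \<longleftrightarrow> k < 1"
proof
  assume same: "same_side (line_through A B) (sphere C side) (pt k 0)"
  show "k < 1"
  proof (rule ccontr)
    assume "\<not> k < 1"
    have "dist (pt 0 1) (pt 0 0) = side"
      by (simp add: dist_pt)
    then have "pt 0 0 \<in> sphere C side - line_through A B"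
      by (auto simp: line_AB simp flip: vertices(3))
    then have "closed_segment (pt 0 0) (pt k 0) \<inter> line_through A B = {}"
      using same by (auto simp: same_side_def)
    moreover have "pt 1 0 \<in> closed_segment (pt 0 0) (pt k 0)"
      using \<open>\<not> k < 1\<close> unfolding segment_pt by (intro exI[of _ "1 / k"]) auto
    ultimately show False
      by (auto simp: line_AB)
  qed
next
  assume k: "k < 1"
  have "x < 1" if "pt x y \<in> sphere C side - line_through A B" for x y
  proof -
    have "dist (pt 0 1) (pt x y) = side"
      using that by (simp flip: vertices)
    then have "x\<^sup>2 + (1 - y)\<^sup>2 = 1"
      using side_pos by (simp add: dist_pt)
    then have "x\<^sup>2 \<le> 1\<^sup>2"
      using zero_le_power2[of "1 - y"] unfolding one_power2 by linarith
    then have "x \<le> 1"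
      by (rule power2_le_imp_le) simp
    moreover have "x \<noteq> 1"
      using that by (auto simp: line_AB)
    ultimately show ?thesis
      by simp
  qed
  moreover have "(1 - t) * x + t * k \<noteq> 1" if "x < 1" "0 \<le> t" "t \<le> 1" for x t
    using convex_bound_lt[OF that(1) k, of "1 - t" t] that by simp
  ultimately have disjoint: "closed_segment (pt x y) (pt k 0) \<inter> line_through A B = {}"
    if "pt x y \<in> sphere C side - line_through A B" for x y
    using that unfolding line_AB segment_pt by (fastforce simp: segment_pt)
  show "same_side (line_through A B) (sphere C side) (pt k 0)"
    unfolding same_side_def
  proof
    fix X
    assume "X \<in> sphere C side - line_through A B"
    moreover obtain x y where "X = pt x y"
      by (rule pt_cases)
    ultimately show "closed_segment X (pt k 0) \<inter> line_through A B = {}"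
      using disjoint by blast
  qed
qed

text \<open>The sign is chosen so that \<open>\<tau>|AK| = side * (1 - 2 * s)\<close>. This includes \<open>K = A\<close>, where \<open>\<tau> = -1\<close>
  and both sides vanish. The quotient is then \<open>(1 - 2 * s) / (2 * s\<^sup>2)\<close>, and adding \<open>1 / 2\<close> completes
  the square.\<close>

lemma haga_nu_fig:
  assumes "s \<noteq> 0"
  shows "haga_nu (fig s) = (1 - 1 / s)\<^sup>2 / 2"
proof -
  have "dist A (pt (2 * s) 0) = dist (pt 1 0) (pt (2 * s) 0)"
    by (simp flip: vertices)
  also have "\<dots> = side * \<bar>1 - 2 * s\<bar>"
    by (simp add: dist_pt)
  finally have "haga_nu (fig s) = (1 - 2 * s) / (2 * s\<^sup>2) + 1 / 2"
    using side_pos assms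
    by (simp add: haga_nu_def Let_def haga_gamma_fig same_side_AB[unfolded side_def]
        side_def[symmetric])
      (auto simp: same_side_AB)
  also have "\<dots> = (1 - 1 / s)\<^sup>2 / 2"
    using assms by (simp add: field_simps power2_eq_square)
  finally show ?thesis .
qed

end

text \<open>The point \<open>T\<close> is inside the square for \<open>0 < s < 1\<close> and outside for \<open>s < 0\<close> and \<open>s > 1\<close>. The value
  at \<open>s = 1\<close>, where \<open>T = B\<close>, is \<open>0\<close>.\<close>

definition haga_number :: "real \<Rightarrow> real" where
  "haga_number s = (if 0 < s \<and> s \<le> 1 then (1 - 1 / s)\<^sup>2 / 2 else - ((1 - 1 / s)\<^sup>2 / 2))"

context square
begin

lemma haga_parameter_fig:
  assumes "s \<noteq> 0"
  shows "haga_parameter (fig s) = Num (haga_number s)"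
proof -
  have s2: "0 < 1 + s\<^sup>2" "0 < s\<^sup>2"
    using assms by (auto simp: add_pos_nonneg)
  have x: "0 < 2 * s / (1 + s\<^sup>2) \<longleftrightarrow> 0 < s" "0 \<le> 2 * s / (1 + s\<^sup>2) \<longleftrightarrow> 0 < s"
      "2 * s / (1 + s\<^sup>2) < 1 \<longleftrightarrow> s \<noteq> 1" "2 * s / (1 + s\<^sup>2) \<le> 1"
  proof -
    have "0 \<le> (s - 1)\<^sup>2" "0 < (s - 1)\<^sup>2 \<longleftrightarrow> s \<noteq> 1"
      by auto
    then show "2 * s / (1 + s\<^sup>2) < 1 \<longleftrightarrow> s \<noteq> 1" "2 * s / (1 + s\<^sup>2) \<le> 1"
      unfolding pos_divide_less_eq[OF s2(1)] pos_divide_le_eq[OF s2(1)]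
      by (simp_all add: power2_diff algebra_simps)
    show "0 < 2 * s / (1 + s\<^sup>2) \<longleftrightarrow> 0 < s" "0 \<le> 2 * s / (1 + s\<^sup>2) \<longleftrightarrow> 0 < s"
      unfolding pos_less_divide_eq[OF s2(1)] pos_le_divide_eq[OF s2(1)] using assms by auto
  qed
  have y0: "0 < 2 * s\<^sup>2 / (1 + s\<^sup>2)"
    by (intro divide_pos_pos mult_pos_pos s2) simp
  have y: "2 * s\<^sup>2 / (1 + s\<^sup>2) < 1 \<longleftrightarrow> \<bar>s\<bar> < 1"
      "2 * s\<^sup>2 / (1 + s\<^sup>2) \<le> 1 \<longleftrightarrow> \<bar>s\<bar> \<le> 1"
    using s2 abs_square_less_1[of s] abs_square_le_1[of s]
    unfolding pos_divide_less_eq[OF s2(1)] pos_divide_le_eq[OF s2(1)] by simp_all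
  have B: "pt x y = B \<longleftrightarrow> x = 1 \<and> y = 1" for x y
    using pt_eq_iff[of x y 1 1] by (simp flip: vertices)
  have D: "pt x y = D \<longleftrightarrow> x = 0 \<and> y = 0" for x y
    using pt_eq_iff[of x y 0 0] by (simp flip: vertices)
  consider "0 < s \<and> s < 1" | "s = 1" | "s < 0 \<or> 1 < s"
    using assms by linarith
  then show ?thesis
    by cases (auto simp: haga_parameter_def Let_def haga_T_fig haga_nu_fig mem_square_region
        mem_interior_square_region x y y0 less_imp_le[OF y0] assms B D haga_number_def)
qed

lemma crease_fig: "pt x y \<in> crease (fig s) \<longleftrightarrow> y = s * x + (1 - s\<^sup>2) / 2"
proof -
  have "midpoint C (pt s 0) = midpoint (pt 0 1) (pt s 0)"
    by (simp flip: vertices)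
  also have "\<dots> = pt (s / 2) (1 / 2)"
    by (simp add: midpoint_pt)
  finally have "pt x y \<in> crease (fig s) \<longleftrightarrow> (pt x y - pt (s / 2) (1 / 2)) \<bullet> (pt s 0 - pt 0 1) = 0"
    by (simp add: crease_def perp_bisector_def flip: vertices)
  also have "\<dots> \<longleftrightarrow> y = s * x + (1 - s\<^sup>2) / 2"
    using side_pos unfolding inner_pt mult_eq_0_iff
    by (simp add: algebra_simps power2_eq_square) (auto simp: field_simps)
  finally show ?thesis .
qed

text \<open>The affine function \<open>y - s * x - (1 - s\<^sup>2) / 2\<close>, which vanishes on the crease, is positive at
  \<open>C\<close>. On the square it is least at \<open>A\<close> if \<open>s > 0\<close> and at \<open>D\<close> if \<open>s \<le> 0\<close>, with the values
  \<open>((s - 1)\<^sup>2 - 2) / 2\<close> and \<open>(s\<^sup>2 - 1) / 2\<close>; the crease enters the square iff the least value is negative.\<close>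

lemma crease_meets_interior_iff:
  "crease (fig s) \<inter> interior (square_region A B C D) \<noteq> {} \<longleftrightarrow> - 1 < s \<and> s < 1 + sqrt 2"
proof
  assume "crease (fig s) \<inter> interior (square_region A B C D) \<noteq> {}"
  then obtain X where X: "X \<in> crease (fig s)" "X \<in> interior (square_region A B C D)"
    by blast
  obtain x y where "X = pt x y"
    by (rule pt_cases)
  then have y: "y = s * x + (1 - s\<^sup>2) / 2" and bounds: "0 < x" "x < 1" "0 < y" "y < 1"
    using X by (simp_all add: crease_fig mem_interior_square_region)
  have "-1 < s"
  proof (rule ccontr)
    assume "\<not> -1 < s"
    then have "1 \<le> s\<^sup>2" "s * x < 0"
      using bounds abs_le_square_iff[of 1 s] by (auto simp: mult_neg_pos)
    then show False
      using y bounds(3) by argo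
  qed
  moreover have "s < 1 + sqrt 2"
  proof (rule ccontr)
    assume s: "\<not> s < 1 + sqrt 2"
    then have "(sqrt 2)\<^sup>2 \<le> (s - 1)\<^sup>2"
      by (intro power_mono) auto
    moreover have "s * x \<le> s * 1"
      using s bounds by (intro mult_left_mono) (auto intro: order_trans[of _ "1 + sqrt 2"])
    ultimately show False
      using y bounds(3) by (simp add: power2_diff) argo
  qed
  ultimately show "- 1 < s \<and> s < 1 + sqrt 2" ..
next
  assume s: "- 1 < s \<and> s < 1 + sqrt 2"
  have "\<exists>x y. y = s * x + (1 - s\<^sup>2) / 2 \<and> 0 < x \<and> x < 1 \<and> 0 < y \<and> y < 1"
  proof (cases "0 < s")
    case True
    \<comment> \<open>the crossing with the diagonal \<open>CA\<close>\<close>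
    define t where "t = (1 + s\<^sup>2) / (2 * (1 + s))"
    have "0 < t"
      using True by (auto simp: t_def add_pos_nonneg)
    moreover have "\<bar>s - 1\<bar> < sqrt 2"
      using s True real_sqrt_gt_1_iff[of 2] by linarith
    then have "\<bar>s - 1\<bar>\<^sup>2 < (sqrt 2)\<^sup>2"
      by (intro power_strict_mono) auto
    then have "t < 1"
      using True by (simp add: t_def power2_diff)
    moreover have "1 - t = s * t + (1 - s\<^sup>2) / 2"
      using True by (simp add: t_def field_simps power2_eq_square)
    ultimately show ?thesis
      by (intro exI[of _ t] exI[of _ "1 - t"]) auto
  next
    case False
    \<comment> \<open>the crossing with the diagonal \<open>DB\<close>\<close>
    have "(1 + s) / 2 = s * ((1 + s) / 2) + (1 - s\<^sup>2) / 2"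
      by (simp add: field_simps power2_eq_square)
    then show ?thesis
      using False s by (intro exI[of _ "(1 + s) / 2"]) auto
  qed
  then obtain x y where "pt x y \<in> crease (fig s)" "pt x y \<in> interior (square_region A B C D)"
    by (auto simp: crease_fig mem_interior_square_region)
  then show "crease (fig s) \<inter> interior (square_region A B C D) \<noteq> {}"
    by blast
qed

end

section \<open>The parameter as a function of the position of E\<close>

lemma haga_number_bounds:
  "s < -1 \<Longrightarrow> -2 < haga_number s \<and> haga_number s < -1/2"
  "haga_number (-1) = -2"
  "-1 < s \<Longrightarrow> s < 0 \<Longrightarrow> haga_number s < -2"
  "0 < s \<Longrightarrow> s < 1 \<Longrightarrow> 0 < haga_number s"
  "haga_number 1 = 0"
  "1 < s \<Longrightarrow> -1/2 < haga_number s \<and> haga_number s < 0"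
proof -
  show "haga_number (-1) = -2" "haga_number 1 = 0"
    by (simp_all add: haga_number_def)
  show "-2 < haga_number s \<and> haga_number s < -1/2" if "s < -1"
  proof -
    have "1 < 1 - 1 / s" "1 - 1 / s < 2"
      using that by (auto simp: field_simps)
    then have "1\<^sup>2 < (1 - 1 / s)\<^sup>2" "(1 - 1 / s)\<^sup>2 < 2\<^sup>2"
      by (intro power_strict_mono; simp)+
    then show ?thesis
      using that by (simp add: haga_number_def)
  qed
  show "haga_number s < -2" if "-1 < s" "s < 0"
  proof -
    have "2 < 1 - 1 / s"
      using that by (auto simp: field_simps)
    then have "2\<^sup>2 < (1 - 1 / s)\<^sup>2"
      by (intro power_strict_mono; simp)
    then show ?thesis
      using that by (simp add: haga_number_def)
  qed
  show "0 < haga_number s" if "0 < s" "s < 1"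
    using that by (simp add: haga_number_def)
  show "-1/2 < haga_number s \<and> haga_number s < 0" if "1 < s"
  proof -
    have "0 < 1 - 1 / s" "1 - 1 / s < 1"
      using that by (auto simp: field_simps)
    then have "0\<^sup>2 < (1 - 1 / s)\<^sup>2" "(1 - 1 / s)\<^sup>2 < 1\<^sup>2"
      by (intro power_strict_mono; simp)+
    then show ?thesis
      using that by (simp add: haga_number_def)
  qed
qed

text \<open>As \<open>s\<close> increases within one of the three ranges, \<open>1 / s\<close> decreases and \<open>1 - 1 / s\<close> keeps its sign,
  which is negative exactly in the middle range, where no sign change is applied to the square.\<close>

lemma haga_number_strict_antimono:
  assumes "s < s'" and "s' < 0 \<or> 0 < s \<and> s' < 1 \<or> 1 < s"
  shows "haga_number s' < haga_number s"
proof -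
  have inv: "1 / s' < 1 / s"
    using assms by (auto simp: field_simps)
  consider "s' < 0" | "0 < s" "s' < 1" | "1 < s"
    using assms by blast
  then show ?thesis
  proof cases
    case 1
    then have "0 < - 1 / s"
      using assms by (simp add: divide_neg_neg)
    then have "(1 - 1 / s)\<^sup>2 < (1 - 1 / s')\<^sup>2"
      using inv by (intro power_strict_mono) auto
    then show ?thesis
      using 1 assms by (simp add: haga_number_def)
  next
    case 2
    then have "1 < 1 / s'"
      using assms by simp
    then have "(1 / s' - 1)\<^sup>2 < (1 / s - 1)\<^sup>2"
      using inv by (intro power_strict_mono) auto
    then show ?thesis
      using 2 assms by (simp add: haga_number_def power2_commute)
  next
    case 3
    then have "1 / s < 1"
      by simp
    then have "(1 - 1 / s)\<^sup>2 < (1 - 1 / s')\<^sup>2"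
      using inv by (intro power_strict_mono) auto
    then show ?thesis
      using 3 assms by (simp add: haga_number_def)
  qed
qed

text \<open>The constant is the value at \<open>s = 1 + sqrt 2\<close>, where the crease passes through \<open>A\<close>: there
  \<open>1 - 1 / s = 2 - sqrt 2 = sqrt 2 * (sqrt 2 - 1)\<close>, and \<open>sqrt 2 - 1\<close> is the inverse of \<open>1 + sqrt 2\<close>.\<close>

lemma haga_number_critical:
  assumes "1 < s"
  shows "- inverse ((1 + sqrt 2)\<^sup>2) < haga_number s \<longleftrightarrow> s < 1 + sqrt 2"
proof -
  have conj: "(1 + sqrt 2) * (sqrt 2 - 1) = 1"
    by (simp add: algebra_simps)
  then have inv: "1 / (1 + sqrt 2) = sqrt 2 - 1"
    by (metis add_pos_pos less_numeral_extra(1,3) nonzero_mult_div_cancel_left real_sqrt_gt_0_iff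
        zero_less_numeral)
  have "inverse ((1 + sqrt 2)\<^sup>2) = (sqrt 2 - 1)\<^sup>2"
    by (simp only: inverse_eq_divide power_one_over[symmetric] inv)
  also have "\<dots> = (2 - sqrt 2)\<^sup>2 / 2"
    by (simp add: power2_diff)
  finally have "- inverse ((1 + sqrt 2)\<^sup>2) < haga_number s \<longleftrightarrow> (1 - 1 / s)\<^sup>2 < (2 - sqrt 2)\<^sup>2"
    using assms by (simp add: haga_number_def)
  also have "\<dots> \<longleftrightarrow> 1 - 1 / s < 2 - sqrt 2"
    using assms sqrt2_less_2 power_mono_iff[of "2 - sqrt 2" "1 - 1 / s" 2]
    by (auto simp flip: not_le)
  also have "\<dots> \<longleftrightarrow> 1 / (1 + sqrt 2) < 1 / s"
    unfolding inv by auto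
  also have "\<dots> \<longleftrightarrow> s < 1 + sqrt 2"
    using assms by (simp add: divide_less_eq less_divide_eq add_pos_pos)
  finally show ?thesis .
qed

section \<open>The cases of the generalized fold\<close>

theorem mainTheorem4:
  fixes A B C D :: point and d \<rho> :: real
    and H :: "point \<Rightarrow> haga_figure" and n :: "point \<Rightarrow> haga_param"
    and h1 h2 h3 h4 h5 h6 h7 :: "point set"
  assumes square: "is_square A B C D"
    and d: "d = dist A B"
    and \<rho>: "\<rho> = (1 + sqrt 2)\<^sup>2"
    and H: "\<And>E. H E = generalized_haga_fold A B C D E"
    and n: "\<And>E. n E = haga_parameter (H E)"
    and h1: "h1 = {E \<in> line_through D A. D \<in> open_segment E A \<and> dist D E > d}"
    and h2: "h2 = {E \<in> line_through D A. D = midpoint E A}"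
    and h3: "h3 = {E \<in> line_through D A. D \<in> open_segment E A \<and> dist D E < d}"
    and h4: "h4 = {E \<in> line_through D A. E = D}"
    and h5: "h5 = {E \<in> line_through D A. E \<in> open_segment D A}"
    and h6: "h6 = {E \<in> line_through D A. E = A}"
    and h7: "h7 = {E \<in> line_through D A. A \<in> open_segment D E}"
  shows
    "(\<forall>E \<in> h1. \<exists>x. n E = Num x \<and> -2 < x \<and> x < -1/2) \<and>
     (\<forall>E \<in> h2. n E = Num (-2)) \<and>
     (\<forall>E \<in> h3. \<exists>x. n E = Num x \<and> x < -2) \<and>
     (\<forall>E \<in> h4. n E = Zero_bar) \<and>
     (\<forall>E \<in> h5. \<exists>x. n E = Num x \<and> 0 < x) \<and>
     (\<forall>E \<in> h6. n E = Num 0) \<and>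
     (\<forall>E \<in> h7. \<exists>x. n E = Num x \<and> -1/2 < x \<and> x < 0) \<and>
     (\<forall>h \<in> {h1, h3, h5, h7}. \<forall>E \<in> h. \<forall>E' \<in> h.
        (\<exists>t>0. E' = E + t *\<^sub>R (A - D)) \<longrightarrow>
        (\<exists>x x'. n E = Num x \<and> n E' = Num x' \<and> x' < x)) \<and>
     (\<forall>E \<in> h3 \<union> h4 \<union> h5 \<union> h6. crease (H E) \<inter> interior (square_region A B C D) \<noteq> {}) \<and>
     (\<forall>E \<in> h1 \<union> h2. crease (H E) \<inter> interior (square_region A B C D) = {}) \<and>
     (\<forall>E \<in> h7. crease (H E) \<inter> interior (square_region A B C D) \<noteq> {} \<longleftrightarrow>
        (\<exists>x. n E = Num x \<and> - inverse \<rho> < x \<and> x < 0))"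
proof -
  interpret square A B C D
    using square by unfold_locales
  have line: "{E \<in> line_through D A. P E} = {pt s 0 | s. P (pt s 0)}" for P
    by (auto simp: line_DA)
  have dist: "dist D (pt s 0) = d * \<bar>s\<bar>" for s
    using dist_pt[of 0 0 s 0] by (simp add: d side_def flip: vertices)
  have d0: "0 < d"
    using side_pos by (simp add: d side_def)
  have h1': "h1 = {pt s 0 | s. s < -1}"
    unfolding h1 line dist using d0 open_segment_DA[of 0 _ 1] mult_less_cancel_left_pos[of d 1]
    by (auto simp flip: vertices)
  have "pt 0 0 = midpoint (pt s 0) (pt 1 0) \<longleftrightarrow> s = -1" for s
  proof -
    have "midpoint (pt s 0) (pt 1 0) = pt ((s + 1) / 2) 0"
      by (simp add: midpoint_pt)
    then show ?thesis
      by auto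
  qed
  then have h2': "h2 = {pt s 0 | s. s = -1}"
    unfolding h2 line by (simp flip: vertices)
  have h3': "h3 = {pt s 0 | s. -1 < s \<and> s < 0}"
    unfolding h3 line dist using d0 open_segment_DA[of 0 _ 1] mult_less_cancel_left_pos[of d _ 1]
    by (auto simp flip: vertices)
  have h4': "h4 = {pt s 0 | s. s = 0}"
    unfolding h4 line using pt_eq_iff[of _ 0 0 0] by (simp flip: vertices)
  have h5': "h5 = {pt s 0 | s. 0 < s \<and> s < 1}"
    unfolding h5 line using open_segment_DA[of _ 0 1] by (auto simp flip: vertices)
  have h6': "h6 = {pt s 0 | s. s = 1}"
    unfolding h6 line using pt_eq_iff[of _ 0 1 0] by (simp flip: vertices)
  have h7': "h7 = {pt s 0 | s. 1 < s}"
    unfolding h7 line using open_segment_DA[of 1 0] by (auto simp flip: vertices)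
  note cases = h1' h2' h3' h4' h5' h6' h7'
  have num: "n (pt s 0) = Num (haga_number s)" if "s \<noteq> 0" for s
    using that by (simp add: n H haga_parameter_fig)
  have bar: "n (pt 0 0) = Zero_bar"
    using fig_sel[of 0] by (simp add: n H haga_parameter_def Let_def flip: vertices)
  have shift: "s < s'" if "pt s' 0 = pt s 0 + t *\<^sub>R (A - D)" "0 < t" for s s' t
  proof -
    have "pt s 0 + t *\<^sub>R (A - D) = pt (s + t) 0"
      by (simp add: pt_def algebra_simps)
    then show ?thesis
      using that by simp
  qed
  have decreasing: "\<exists>x x'. n E = Num x \<and> n E' = Num x' \<and> x' < x"
    if h: "h \<in> {h1, h3, h5, h7}" and E: "E \<in> h" "E' \<in> h" and t: "\<exists>t>0. E' = E + t *\<^sub>R (A - D)"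
    for h E E'
  proof -
    obtain s s' where s: "E = pt s 0" "E' = pt s' 0"
        "s' < 0 \<and> s < 0 \<or> 0 < s \<and> 0 < s' \<and> s' < 1 \<or> 1 < s \<and> 1 < s'"
      using h E unfolding cases by fastforce
    then have "s < s'"
      using t shift by auto
    then have "haga_number s' < haga_number s"
      using s(3) by (intro haga_number_strict_antimono) auto
    moreover have "s \<noteq> 0" "s' \<noteq> 0"
      using s(3) by auto
    ultimately show ?thesis
      using s num by blast
  qed
  have crease: "crease (H (pt s 0)) \<inter> interior (square_region A B C D) \<noteq> {} \<longleftrightarrow>
      - 1 < s \<and> s < 1 + sqrt 2" for s
    unfolding H by (rule crease_meets_interior_iff)
  have meets: "crease (H (pt s 0)) \<inter> interior (square_region A B C D) \<noteq> {}"
    if "-1 < s" "s \<le> 1" for s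
    unfolding crease using that less_le_trans[of s "1 + sqrt 2"] real_sqrt_gt_zero[of 2] by linarith
  have outside: "crease (H (pt s 0)) \<inter> interior (square_region A B C D) = {}" if "s \<le> -1" for s
    using that crease[of s] by auto
  have crease': "crease (H (pt s 0)) \<inter> interior (square_region A B C D) \<noteq> {} \<longleftrightarrow>
      (\<exists>x. n (pt s 0) = Num x \<and> - inverse \<rho> < x \<and> x < 0)" if "1 < s" for s
    using that haga_number_critical[of s] haga_number_bounds(6)[of s]
    unfolding crease \<rho> by (auto simp: num)
  have "\<forall>E \<in> h1. \<exists>x. n E = Num x \<and> -2 < x \<and> x < -1/2"
    using haga_number_bounds(1) num unfolding cases by force
  moreover have "\<forall>E \<in> h2. n E = Num (-2)"
    using haga_number_bounds(2) num unfolding cases by force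
  moreover have "\<forall>E \<in> h3. \<exists>x. n E = Num x \<and> x < -2"
    using haga_number_bounds(3) num unfolding cases by force
  moreover have "\<forall>E \<in> h4. n E = Zero_bar"
    using bar unfolding cases by auto
  moreover have "\<forall>E \<in> h5. \<exists>x. n E = Num x \<and> 0 < x"
    using haga_number_bounds(4) num unfolding cases by force
  moreover have "\<forall>E \<in> h6. n E = Num 0"
    using haga_number_bounds(5) num unfolding cases by force
  moreover have "\<forall>E \<in> h7. \<exists>x. n E = Num x \<and> -1/2 < x \<and> x < 0"
    using haga_number_bounds(6) num unfolding cases by force
  moreover have "\<forall>h \<in> {h1, h3, h5, h7}. \<forall>E \<in> h. \<forall>E' \<in> h.
      (\<exists>t>0. E' = E + t *\<^sub>R (A - D)) \<longrightarrow> (\<exists>x x'. n E = Num x \<and> n E' = Num x' \<and> x' < x)"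
    using decreasing by blast
  moreover have "\<forall>E \<in> h3 \<union> h4 \<union> h5 \<union> h6.
      crease (H E) \<inter> interior (square_region A B C D) \<noteq> {}"
    using meets unfolding cases by auto
  moreover have "\<forall>E \<in> h1 \<union> h2. crease (H E) \<inter> interior (square_region A B C D) = {}"
  proof
    fix E
    assume "E \<in> h1 \<union> h2"
    then obtain s where "E = pt s 0" "s \<le> -1"
      unfolding cases by fastforce
    then show "crease (H E) \<inter> interior (square_region A B C D) = {}"
      using outside by simp
  qed
  moreover have "\<forall>E \<in> h7. crease (H E) \<inter> interior (square_region A B C D) \<noteq> {} \<longleftrightarrow>
      (\<exists>x. n E = Num x \<and> - inverse \<rho> < x \<and> x < 0)"
    using crease' unfolding cases by blast
  ultimately show ?thesis
    by (intro conjI)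
qed

end
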